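(* There are $2^{\omega}$ many clones of self-dual operations on $\{0,1,2\}$ with respect to homomorphic equivalence; that is, the set of homomorphic-equivalence classes of clones of self-dual operations on $\{0,1,2\}$ has cardinality $2^{\omega}$.
   Context: An operation clone on a set $A$ is a set of finitary operations on $A$ that contains all projections and is closed under composition. An operation $f\colon\{0,1,2\}^n\to\{0,1,2\}$ is called self-dual if it preserves the relation $C_3=\{(0,1),(1,2),(2,0)\}$ (applying $f$ componentwise to tuples of $C_3$ yields a tuple of $C_3$). A clone of self-dual operations is an operation clone on $\{0,1,2\}$ all of whose operations are self-dual. A clone homomorphism from a clone $\mathbf C$ to a clone $\mathbf D$ is a map $\mathbf C\to\mathbf D$ that preserves arities, preserves composition, and maps the $i$-th projection of arity $n$ in $\mathbf C$ to the $i$-th projection of arity $n$ in $\mathbf D$. Two clones are homomorphically equivalent if there are clone homomorphisms between them in both directions. *)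

theory Defs
  imports "HOL-Library.FuncSet" "HOL-Library.NList" "HOL-Library.Equipollence"
begin

text \<open>
  A finitary operation on \<open>A\<close> is a pair \<open>(n, f)\<close> of an arity and a map from \<open>A\<^sup>n\<close> to \<open>A\<close>. Elements of
  \<open>A\<^sup>n\<close> are lists of length \<open>n\<close>; \<open>f\<close> is extensional, so that equality of pairs is equality of
  operations. The arity is recorded because the extensional function alone need not determine it.
\<close>

type_synonym 'a operation = "nat \<times> ('a list \<Rightarrow> 'a)"

abbreviation arity :: "'a operation \<Rightarrow> nat" where
  "arity f \<equiv> fst f"

abbreviation app :: "'a operation \<Rightarrow> 'a list \<Rightarrow> 'a" where
  "app f \<equiv> snd f"

text \<open>Nullary operations are admitted; self-duality excludes them (lemma \<open>arity_pos\<close> below).\<close>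

definition operations :: "'a set \<Rightarrow> 'a operation set" where
  "operations A = (SIGMA n:UNIV. nlists n A \<rightarrow>\<^sub>E A)"

definition proj :: "'a set \<Rightarrow> nat \<Rightarrow> nat \<Rightarrow> 'a operation" where
  "proj A n i = (n, \<lambda>xs\<in>nlists n A. xs ! i)"

text \<open>
  \<open>f(g\<^sub>1, \<dots>, g\<^sub>n)\<close> for \<open>k\<close>-ary \<open>g\<^sub>i\<close>; the arity \<open>k\<close> is an argument because it cannot be read off
  the \<open>g\<^sub>i\<close> when \<open>n = 0\<close>.
\<close>

definition comp_op :: "'a set \<Rightarrow> nat \<Rightarrow> 'a operation \<Rightarrow> 'a operation list \<Rightarrow> 'a operation" where
  "comp_op A k f gs = (k, \<lambda>xs\<in>nlists k A. app f (map (\<lambda>g. app g xs) gs))"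

definition composable :: "nat \<Rightarrow> 'a operation \<Rightarrow> 'a operation list \<Rightarrow> bool" where
  "composable k f gs \<longleftrightarrow> length gs = arity f \<and> (\<forall>g\<in>set gs. arity g = k)"

definition clone :: "'a set \<Rightarrow> 'a operation set \<Rightarrow> bool" where
  "clone A C \<longleftrightarrow>
     C \<subseteq> operations A \<and>
     (\<forall>n. \<forall>i<n. proj A n i \<in> C) \<and>
     (\<forall>k. \<forall>f\<in>C. \<forall>gs\<in>lists C. composable k f gs \<longrightarrow> comp_op A k f gs \<in> C)"

definition clone_hom ::
  "'a set \<Rightarrow> 'a operation set \<Rightarrow> 'b set \<Rightarrow> 'b operation set \<Rightarrow> ('a operation \<Rightarrow> 'b operation) \<Rightarrow> bool" where
  "clone_hom A C B D \<phi> \<longleftrightarrow>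
     \<phi> \<in> C \<rightarrow> D \<and>
     (\<forall>f\<in>C. arity (\<phi> f) = arity f) \<and>
     (\<forall>n. \<forall>i<n. \<phi> (proj A n i) = proj B n i) \<and>
     (\<forall>k. \<forall>f\<in>C. \<forall>gs\<in>lists C. composable k f gs \<longrightarrow>
        \<phi> (comp_op A k f gs) = comp_op B k (\<phi> f) (map \<phi> gs))"

definition hom_equivalent :: "'a set \<Rightarrow> 'a operation set \<Rightarrow> 'b set \<Rightarrow> 'b operation set \<Rightarrow> bool" where
  "hom_equivalent A C B D \<longleftrightarrow> (\<exists>\<phi>. clone_hom A C B D \<phi>) \<and> (\<exists>\<psi>. clone_hom B D A C \<psi>)"

definition preserves :: "'a operation \<Rightarrow> ('a \<times> 'a) set \<Rightarrow> bool" where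
  "preserves f R \<longleftrightarrow> (\<forall>ps\<in>nlists (arity f) R. (app f (map fst ps), app f (map snd ps)) \<in> R)"

abbreviation three :: "nat set" where
  "three \<equiv> {0, 1, 2}"

definition C3 :: "(nat \<times> nat) set" where
  "C3 = {(0, 1), (1, 2), (2, 0)}"

definition self_dual :: "nat operation \<Rightarrow> bool" where
  "self_dual f \<longleftrightarrow> f \<in> operations three \<and> preserves f C3"

definition self_dual_clones :: "nat operation set set" where
  "self_dual_clones = {C. clone three C \<and> (\<forall>f\<in>C. self_dual f)}"

definition hom_equivalence :: "(nat operation set \<times> nat operation set) set" where
  "hom_equivalence =
     {(C, D) \<in> self_dual_clones \<times> self_dual_clones. hom_equivalent three C three D}"

lemma arity_pos:
  assumes "self_dual f"
  shows "0 < arity f"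
proof (rule ccontr)
  assume "\<not> 0 < arity f"
  then have "arity f = 0"
    by (simp only: not_gr_zero)
  then have "[] \<in> nlists (arity f) C3"
    by (intro nlistsI) (simp_all only: list.size list.set empty_subsetI)
  moreover have "\<forall>ps\<in>nlists (arity f) C3. (app f (map fst ps), app f (map snd ps)) \<in> C3"
    using assms unfolding self_dual_def preserves_def by (rule conjunct2)
  ultimately have "(app f [], app f []) \<in> C3"
    by force
  moreover have "(x, x) \<notin> C3" for x
    by (auto simp: C3_def)
  ultimately show False
    by blast
qed

lemma clone_hom_id: "clone_hom A C A C (\<lambda>f. f)"
  by (simp add: clone_hom_def)

lemma clone_hom_trans:
  assumes "clone_hom A C B D \<phi>" and "clone_hom B D E F \<psi>"
  shows "clone_hom A C E F (\<lambda>f. \<psi> (\<phi> f))"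
proof -
  have \<phi>: "\<phi> f \<in> D" "arity (\<phi> f) = arity f" if "f \<in> C" for f
    using assms(1) that unfolding clone_hom_def by blast+
  have \<psi>: "\<psi> f \<in> F" "arity (\<psi> f) = arity f" if "f \<in> D" for f
    using assms(2) that unfolding clone_hom_def by blast+
  have proj: "\<phi> (proj A n i) = proj B n i" "\<psi> (proj B n i) = proj E n i" if "i < n" for n i
    using assms that unfolding clone_hom_def by blast+
  have comp: "\<psi> (\<phi> (comp_op A k f gs)) = comp_op E k (\<psi> (\<phi> f)) (map (\<lambda>f. \<psi> (\<phi> f)) gs)"
    if f: "f \<in> C" and gs: "gs \<in> lists C" and c: "composable k f gs" for k f gs
  proof -
    have "map \<phi> gs \<in> lists D"
      using gs \<phi>(1) by (simp add: in_lists_conv_set)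
    moreover have "composable k (\<phi> f) (map \<phi> gs)"
      using f gs c \<phi>(2) by (simp add: composable_def in_lists_conv_set)
    ultimately have "\<psi> (comp_op B k (\<phi> f) (map \<phi> gs)) = comp_op E k (\<psi> (\<phi> f)) (map \<psi> (map \<phi> gs))"
      using assms(2) \<phi>(1)[OF f] unfolding clone_hom_def by blast
    moreover have "\<phi> (comp_op A k f gs) = comp_op B k (\<phi> f) (map \<phi> gs)"
      using assms(1) f gs c unfolding clone_hom_def by blast
    ultimately show ?thesis
      by (simp add: comp_def)
  qed
  show ?thesis
    unfolding clone_hom_def by (intro conjI allI ballI impI Pi_I) (simp_all add: \<phi> \<psi> proj comp)
qed

lemma equiv_hom_equivalence: "equiv self_dual_clones hom_equivalence"
proof (rule equivI)
  show "hom_equivalence \<subseteq> self_dual_clones \<times> self_dual_clones"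
    unfolding hom_equivalence_def by blast
  show "refl_on self_dual_clones hom_equivalence"
    unfolding refl_on_def hom_equivalence_def hom_equivalent_def using clone_hom_id by blast
  show "sym hom_equivalence"
    unfolding sym_def hom_equivalence_def hom_equivalent_def by blast
  show "trans hom_equivalence"
    unfolding trans_def hom_equivalence_def hom_equivalent_def
    by (blast intro: clone_hom_trans)
qed

end

theory Submission imports Defs "HOL-Library.Countable_Set" begin

text \<open>
  Let \<open>rps\<close> be the commutative idempotent self-dual operation that picks the larger of two elements
  in the cyclic order \<open>0 < 1 < 2 < 0\<close>. A clone homomorphism between idempotent clones of self-dual
  operations that fixes \<open>rps\<close> fixes every operation: terms in \<open>rps\<close> collapse the triples with a
  repetition, fix \<open>(0, 1, 2)\<close> and rotate \<open>(0, 2, 1)\<close> by any prescribed amount, so every ternary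
  operation, after substituting suitable terms, becomes itself a term with the same value at
  \<open>(0, 1, 2)\<close>. If the target preserves the binary disjunction on \<open>{0, 1}\<close>, then \<open>rps\<close> is its only
  commutative idempotent binary operation and hence is fixed. So homomorphic equivalence of such
  clones is equality, and it suffices to exhibit operations \<open>spike_op n\<close> and relations \<open>guarded n\<close>
  such that \<open>rps\<close> preserves all the relations and \<open>spike_op m\<close> preserves \<open>guarded n\<close> if and only
  if \<open>m \<noteq> n\<close>.
\<close>

section \<open>Operations and clones\<close>

text \<open>As simplification rules these two loop with \<open>nlists_iff\<close>.\<close>

declare nlistsE_length [simp del] nlistsE_set [simp del]

lemma nlists_iff: "xs \<in> nlists n A \<longleftrightarrow> length xs = n \<and> set xs \<subseteq> A"
  by (simp add: nlists_def)

lemma nlists_2E: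
  assumes "xs \<in> nlists 2 A"
  obtains x y where "xs = [x, y]" "x \<in> A" "y \<in> A"
  using assms that by (auto simp: nlists_iff numeral_2_eq_2 length_Suc_conv)

lemma nlists_3E:
  assumes "xs \<in> nlists 3 A"
  obtains x y z where "xs = [x, y, z]" "x \<in> A" "y \<in> A" "z \<in> A"
  using assms that by (auto simp: nlists_iff numeral_3_eq_3 length_Suc_conv)

lemma operation_eqI:
  assumes "f \<in> operations A" "g \<in> operations A" "arity f = arity g"
    and "\<And>xs. xs \<in> nlists (arity f) A \<Longrightarrow> app f xs = app g xs"
  shows "f = g"
proof (rule prod_eqI, rule assms(3))
  have "app f \<in> nlists (arity f) A \<rightarrow>\<^sub>E A" "app g \<in> nlists (arity f) A \<rightarrow>\<^sub>E A"
    using assms(1-3) by (auto simp: operations_def)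
  then show "app f = app g"
    using assms(4) by (rule PiE_ext)
qed

lemma app_closed: "f \<in> operations A \<Longrightarrow> xs \<in> nlists (arity f) A \<Longrightarrow> app f xs \<in> A"
  by (auto simp: operations_def)

lemma app_proj: "xs \<in> nlists n A \<Longrightarrow> app (proj A n i) xs = xs ! i"
  by (simp add: proj_def)

lemma app_comp_op:
  "xs \<in> nlists k A \<Longrightarrow> app (comp_op A k f gs) xs = app f (map (\<lambda>g. app g xs) gs)"
  by (simp add: comp_op_def)

lemma arity_proj [simp]: "arity (proj A n i) = n"
  by (simp add: proj_def)

lemma arity_comp_op [simp]: "arity (comp_op A k f gs) = k"
  by (simp add: comp_op_def)

lemma proj_operation: "i < n \<Longrightarrow> proj A n i \<in> operations A"
  by (auto simp: proj_def operations_def intro: nlistsE_nth_in)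

lemma map_app_nlists:
  assumes "gs \<in> lists (operations A)" "composable k f gs" "xs \<in> nlists k A"
  shows "map (\<lambda>g. app g xs) gs \<in> nlists (arity f) A"
  using assms by (auto simp: composable_def nlists_iff in_lists_conv_set intro!: app_closed)

lemma comp_operation:
  assumes "f \<in> operations A" "gs \<in> lists (operations A)" "composable k f gs"
  shows "comp_op A k f gs \<in> operations A"
  using assms map_app_nlists[OF assms(2,3)]
  by (auto simp: comp_op_def operations_def)

lemma clone_comp:
  "clone A C \<Longrightarrow> f \<in> C \<Longrightarrow> gs \<in> lists C \<Longrightarrow> composable k f gs \<Longrightarrow> comp_op A k f gs \<in> C"
  unfolding clone_def by blast

lemma clone_proj: "clone A C \<Longrightarrow> i < n \<Longrightarrow> proj A n i \<in> C"
  unfolding clone_def by blast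

lemma clone_homD:
  assumes "clone_hom A C B D \<phi>"
  shows "f \<in> C \<Longrightarrow> \<phi> f \<in> D" "f \<in> C \<Longrightarrow> arity (\<phi> f) = arity f"
    "i < n \<Longrightarrow> \<phi> (proj A n i) = proj B n i"
    "f \<in> C \<Longrightarrow> gs \<in> lists C \<Longrightarrow> composable k f gs \<Longrightarrow>
       \<phi> (comp_op A k f gs) = comp_op B k (\<phi> f) (map \<phi> gs)"
  using assms unfolding clone_hom_def by blast+

section \<open>Relations of arbitrary arity\<close>

text \<open>Tuples are functions on an index type, so that a relation may have several kinds of
  coordinates; \<open>preserves\<close> covers binary relations only.\<close>

definition compatible :: "'a operation \<Rightarrow> ('i \<Rightarrow> 'a) set \<Rightarrow> bool" where
  "compatible f R \<longleftrightarrow>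
     (\<forall>gs\<in>nlists (arity f) R. (\<lambda>c. app f (map (\<lambda>g. g c) gs)) \<in> R)"

text \<open>\<open>proj\<close> is \<open>undefined\<close> on lists that leave \<open>A\<close>, so
  every coordinate of a tuple has to lie in \<open>A\<close> for the pointwise image to be one of
  the given tuples.\<close>

lemma compatible_proj:
  assumes "i < n" "\<And>x c. x \<in> R \<Longrightarrow> x c \<in> A"
  shows "compatible (proj A n i) R"
proof -
  have "(\<lambda>c. app (proj A n i) (map (\<lambda>g. g c) gs)) = gs ! i" if "gs \<in> nlists n R" for gs
  proof
    fix c
    have "map (\<lambda>g. g c) gs \<in> nlists n A"
      using that assms(2) by (auto simp: nlists_iff)
    then show "app (proj A n i) (map (\<lambda>g. g c) gs) = (gs ! i) c"
      using that assms(1) by (simp add: app_proj nlistsE_length)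
  qed
  then show ?thesis
    using assms(1) by (auto simp: compatible_def nlists_iff subset_iff)
qed

lemma compatible_comp:
  assumes f: "compatible f R" and gs: "\<forall>g\<in>set gs. compatible g R"
    and c: "composable k f gs" and A: "\<And>x c. x \<in> R \<Longrightarrow> x c \<in> A"
  shows "compatible (comp_op A k f gs) R"
  unfolding compatible_def
proof
  fix xs assume "xs \<in> nlists (arity (comp_op A k f gs)) R"
  then have xs: "xs \<in> nlists k R" by simp
  have row: "map (\<lambda>x. x c) xs \<in> nlists k A" for c
    using xs A by (auto simp: nlists_iff)
  define ys where "ys = map (\<lambda>g c. app g (map (\<lambda>x. x c) xs)) gs"
  have "ys \<in> nlists (arity f) R"
    using gs c xs by (auto simp: ys_def nlists_iff composable_def compatible_def)
  then have "(\<lambda>c. app f (map (\<lambda>y. y c) ys)) \<in> R"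
    using f by (simp add: compatible_def)
  then show "(\<lambda>c. app (comp_op A k f gs) (map (\<lambda>x. x c) xs)) \<in> R"
    by (simp add: app_comp_op[OF row] ys_def o_def)
qed

lemma row_nlists:
  assumes "gs \<in> nlists k R" "\<And>x. x \<in> R \<Longrightarrow> x c \<in> A"
  shows "map (\<lambda>g. g c) gs \<in> nlists k A"
  using assms by (auto simp: nlists_iff)

section \<open>Self-duality\<close>

definition rot :: "nat \<Rightarrow> nat" where
  "rot x = (x + 1) mod 3"

lemma rot_simps [simp]: "rot 0 = 1" "rot 1 = 2" "rot (Suc 0) = 2" "rot 2 = 0"
  by (simp_all add: rot_def)

lemma rot_three: "x \<in> three \<Longrightarrow> rot x \<in> three"
  by auto

lemma rot_inj: "x \<in> three \<Longrightarrow> y \<in> three \<Longrightarrow> rot x = rot y \<longleftrightarrow> x = y"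
  by auto

text \<open>\<open>C3\<close> is the graph of \<open>rot\<close> on \<open>three\<close>.\<close>

lemma self_dual_iff:
  "self_dual f \<longleftrightarrow> f \<in> operations three \<and>
     (\<forall>xs\<in>nlists (arity f) three. app f (map rot xs) = rot (app f xs))"
proof -
  have C3_iff: "(x, y) \<in> C3 \<longleftrightarrow> x \<in> three \<and> y = rot x" for x y
    by (auto simp: C3_def)
  have "preserves f C3 \<longleftrightarrow> (\<forall>xs\<in>nlists (arity f) three. app f (map rot xs) = rot (app f xs))"
    if f: "f \<in> operations three"
  proof
    assume p: "preserves f C3"
    show "\<forall>xs\<in>nlists (arity f) three. app f (map rot xs) = rot (app f xs)"
    proof
      fix xs assume xs: "xs \<in> nlists (arity f) three"
      have "map (\<lambda>x. (x, rot x)) xs \<in> nlists (arity f) C3"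
        using xs by (auto simp: nlists_iff C3_iff subset_iff)
      then show "app f (map rot xs) = rot (app f xs)"
        using p unfolding preserves_def by (fastforce simp: o_def C3_iff)
    qed
  next
    assume r: "\<forall>xs\<in>nlists (arity f) three. app f (map rot xs) = rot (app f xs)"
    show "preserves f C3"
      unfolding preserves_def
    proof
      fix ps assume ps: "ps \<in> nlists (arity f) C3"
      then have "set ps \<subseteq> C3" by (simp add: nlists_iff)
      then have fst: "map fst ps \<in> nlists (arity f) three" and snd: "map snd ps = map rot (map fst ps)"
        using ps by (auto simp: nlists_iff C3_iff)
      show "(app f (map fst ps), app f (map snd ps)) \<in> C3"
        unfolding C3_iff snd by (rule conjI[OF app_closed[OF f fst] bspec[OF r fst]])
    qed
  qed
  then show ?thesis
    unfolding self_dual_def by blast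
qed

lemma map_rot_nlists: "xs \<in> nlists n three \<Longrightarrow> map rot xs \<in> nlists n three"
  using rot_three by (auto simp: nlists_iff simp del: insert_iff)

lemma self_dual_proj: "i < n \<Longrightarrow> self_dual (proj three n i)"
  by (auto simp: self_dual_iff proj_operation app_proj map_rot_nlists nlistsE_length
      simp del: One_nat_def)

lemma self_dual_comp:
  assumes "self_dual f" "\<forall>g\<in>set gs. self_dual g" "composable k f gs"
  shows "self_dual (comp_op three k f gs)"
  unfolding self_dual_iff
proof (intro conjI ballI)
  have gs: "gs \<in> lists (operations three)"
    using assms(2) by (auto simp: self_dual_iff)
  show "comp_op three k f gs \<in> operations three"
    using assms gs by (intro comp_operation) (auto simp: self_dual_iff)
  fix xs assume "xs \<in> nlists (arity (comp_op three k f gs)) three"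
  then have xs: "xs \<in> nlists k three" by simp
  then have rxs: "map rot xs \<in> nlists k three"
    by (rule map_rot_nlists)
  have "map (\<lambda>g. app g (map rot xs)) gs = map rot (map (\<lambda>g. app g xs) gs)"
    using assms(2,3) xs by (auto simp: self_dual_iff composable_def)
  then show "app (comp_op three k f gs) (map rot xs) = rot (app (comp_op three k f gs) xs)"
    using assms(1) map_app_nlists[OF gs assms(3) xs]
    by (simp only: app_comp_op[OF xs] app_comp_op[OF rxs] self_dual_iff)
qed

section \<open>The cyclic maximum\<close>

definition rps :: "nat \<Rightarrow> nat \<Rightarrow> nat" where
  "rps x y = (if y = rot x then y else x)"

lemma rps_three: "x \<in> three \<Longrightarrow> y \<in> three \<Longrightarrow> rps x y \<in> three"
  by (auto simp: rps_def)

lemma rps_rot: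
  assumes "x \<in> three" "y \<in> three"
  shows "rps (rot x) (rot y) = rot (rps x y)"
proof -
  have "rot y = rot (rot x) \<longleftrightarrow> y = rot x"
    by (rule rot_inj[OF assms(2) rot_three[OF assms(1)]])
  then show ?thesis
    unfolding rps_def by presburger
qed

lemma rps_table:
  "rps x x = x" "rps 0 1 = 1" "rps 1 0 = 1" "rps 1 2 = 2" "rps 2 1 = 2" "rps 0 2 = 0" "rps 2 0 = 0"
  "rps 0 (Suc 0) = Suc 0" "rps (Suc 0) 0 = Suc 0" "rps (Suc 0) 2 = 2" "rps 2 (Suc 0) = 2"
  by (simp_all add: rps_def)

definition rps_op :: "nat operation" where
  "rps_op = (2, \<lambda>xs\<in>nlists 2 three. rps (xs ! 0) (xs ! 1))"

lemma self_dual_rps: "self_dual rps_op"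
proof -
  have *: "xs \<in> nlists 2 three \<Longrightarrow> xs ! 0 \<in> three \<and> xs ! 1 \<in> three" for xs
    by (auto simp: nlists_iff subset_iff)
  show ?thesis
    using * map_rot_nlists by (auto simp: self_dual_iff rps_op_def operations_def nlists_iff rps_rot rps_three
        simp del: One_nat_def insert_iff)
qed

lemma arity_rps [simp]: "arity rps_op = 2"
  by (simp add: rps_op_def)

lemma rps_operation: "rps_op \<in> operations three"
  using self_dual_rps by (simp add: self_dual_iff)

lemma app_rps_op: "x \<in> three \<Longrightarrow> y \<in> three \<Longrightarrow> app rps_op [x, y] = rps x y"
  by (simp add: rps_op_def nlists_iff del: insert_iff)

text \<open>\<open>rps\<close> is not associative, so a bracketing has to be fixed; on lists over
  \<open>three\<close> with at most two distinct values all bracketings agree. The value at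
  \<open>[]\<close> is a default.\<close>

fun rps_list :: "nat list \<Rightarrow> nat" where
  "rps_list [] = 0"
| "rps_list [x] = x"
| "rps_list (x # y # zs) = rps x (rps_list (y # zs))"

lemma rps_list_in: "xs \<noteq> [] \<Longrightarrow> rps_list xs \<in> set xs"
  by (induction xs rule: rps_list.induct) (auto simp: rps_def)

lemma rps_list_rot:
  "xs \<noteq> [] \<Longrightarrow> set xs \<subseteq> three \<Longrightarrow> rps_list (map rot xs) = rot (rps_list xs)"
proof (induction xs rule: rps_list.induct)
  case (3 x y zs)
  have "rps_list (y # zs) \<in> three"
    using 3(3) rps_list_in[of "y # zs"] by auto
  then show ?case
    using 3 by (simp add: rps_rot)
qed auto

text \<open>On \<open>{a, rot a}\<close> the operation \<open>rps\<close> is a semilattice operation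
  with top \<open>rot a\<close>.\<close>

lemma rps_list_two:
  assumes "xs \<noteq> []" "a \<in> three" "set xs \<subseteq> {a, rot a}"
  shows "rps_list xs = (if rot a \<in> set xs then rot a else a)"
  using assms by (induction xs rule: rps_list.induct) (auto simp: rps_def)

section \<open>The operations and the relations\<close>

lemma other_index: "2 \<le> n \<Longrightarrow> \<exists>i<n. i \<noteq> (k::nat)"
  by (cases "k = 0") (auto intro: exI[of _ 0] exI[of _ 1])

lemma take_nth_set: "n \<le> length xs \<Longrightarrow> set (take n xs) = (!) xs ` {..<n}"
  by (simp add: nth_image lessThan_atLeast0)

text \<open>
  \<open>spike n\<close> takes \<open>n\<close> arguments \<open>w\<close> followed by \<open>n\<close> arguments \<open>v\<close> and returns the cyclic maximum of
  the \<open>w\<close>, with two exceptions: \<open>(a, \<dots>, a; a + 1, \<dots>, a + 1)\<close> is sent to \<open>a + 1\<close>; and if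
  \<open>w\<close> is constantly \<open>a\<close> except for one entry \<open>a + 1\<close> at \<open>k\<close>, while \<open>v\<close> is constantly \<open>a\<close> except for
  one entry \<open>a + 2\<close> at the same \<open>k\<close>, the value is \<open>a\<close>. Here \<open>a\<close> is computed as \<open>m + 2\<close> from the
  cyclic maximum \<open>m = a + 1\<close>.
\<close>

definition spike :: "nat \<Rightarrow> nat list \<Rightarrow> nat" where
  "spike n xs =
     (let w = (\<lambda>i. xs ! i); v = (\<lambda>i. xs ! (n + i)); m = rps_list (take n xs) in
      if \<forall>i<n. \<forall>j<n. v j = rot (w i) then rot m
      else if \<exists>k<n. v k = rot (w k) \<and> (\<forall>i<n. i \<noteq> k \<longrightarrow> w k = rot (w i) \<and> v i = w i)
        then rot (rot m)
      else m)"

definition spike_op :: "nat \<Rightarrow> nat operation" where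
  "spike_op n = (2 * n, \<lambda>xs\<in>nlists (2 * n) three. spike n xs)"

lemma spike_in:
  assumes "0 < n" "xs \<in> nlists (2 * n) three"
  shows "spike n xs \<in> three"
proof -
  have "take n xs \<noteq> []" "set (take n xs) \<subseteq> three"
    using assms set_take_subset[of n xs] by (auto simp: nlists_iff)
  then have "rps_list (take n xs) \<in> three"
    using rps_list_in by blast
  then show ?thesis
    unfolding spike_def Let_def using rot_three by presburger
qed

text \<open>Both exceptions are equations between entries and their rotations, hence invariant
  because \<open>rot\<close> is injective; the cyclic maximum commutes with
  \<open>rot\<close>.\<close>

lemma spike_rot:
  assumes n: "0 < n" and xs: "xs \<in> nlists (2 * n) three"
  shows "spike n (map rot xs) = rot (spike n xs)"
proof -
  have t: "xs ! i \<in> three" "xs ! (n + i) \<in> three" "rot (xs ! i) \<in> three" if "i < n" for i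
    using that nlistsE_nth_in[OF xs, of i] nlistsE_nth_in[OF xs, of "n + i"] rot_three
    by (simp_all del: insert_iff)
  have l: "i < length xs" "n + i < length xs" if "i < n" for i
    using xs that by (auto simp: nlists_iff)
  have ne: "take n xs \<noteq> []" "set (take n xs) \<subseteq> three"
    using assms set_take_subset[of n xs] by (auto simp: nlists_iff)
  have m: "rps_list (take n (map rot xs)) = rot (rps_list (take n xs))"
    using rps_list_rot[OF ne] by (simp add: take_map)
  have e1: "(\<forall>i<n. \<forall>j<n. map rot xs ! (n + j) = rot (map rot xs ! i)) \<longleftrightarrow>
      (\<forall>i<n. \<forall>j<n. xs ! (n + j) = rot (xs ! i))"
    using t l by (simp add: rot_inj del: insert_iff)
  have e2: "(\<exists>k<n. map rot xs ! (n + k) = rot (map rot xs ! k) \<and>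
        (\<forall>i<n. i \<noteq> k \<longrightarrow> map rot xs ! k = rot (map rot xs ! i) \<and> map rot xs ! (n + i) = map rot xs ! i)) \<longleftrightarrow>
      (\<exists>k<n. xs ! (n + k) = rot (xs ! k) \<and>
        (\<forall>i<n. i \<noteq> k \<longrightarrow> xs ! k = rot (xs ! i) \<and> xs ! (n + i) = xs ! i))"
    using t l by (simp add: rot_inj del: insert_iff cong: conj_cong)
  show ?thesis
    unfolding spike_def Let_def m e1 e2 by (simp only: if_distrib[of rot])
qed

lemma self_dual_spike: "0 < n \<Longrightarrow> self_dual (spike_op n)"
proof -
  assume n: "0 < n"
  show ?thesis
    using map_rot_nlists spike_in[OF n] spike_rot[OF n]
    by (auto simp: self_dual_iff spike_op_def operations_def simp del: insert_iff)
qed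

text \<open>The second exception needs three different values, so on Boolean arguments only the
  first, with \<open>a = 0\<close>, can occur. The result is the disjunction of all \<open>w\<close>
  and of the conjunction of the \<open>v\<close>.\<close>

lemma spike_bool:
  assumes n: "2 \<le> n" and xs: "xs \<in> nlists (2 * n) {0, 1}"
  shows "spike n xs =
    (if (\<forall>i<n. xs ! i = 0) \<and> (\<exists>j<n. xs ! (n + j) = 0) then 0 else 1)"
proof -
  have b: "xs ! i \<in> {0, 1}" "xs ! (n + i) \<in> {0, 1}" if "i < n" for i
    using xs that nlistsE_nth_in[OF xs, of i] nlistsE_nth_in[OF xs, of "n + i"] by (simp_all del: insert_iff)
  have len: "n \<le> length xs" using xs by (simp add: nlists_iff)
  have "take n xs \<noteq> []" "set (take n xs) \<subseteq> {0, rot 0}"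
    using n xs set_take_subset[of n xs] by (auto simp: nlists_iff)
  from rps_list_two[OF this(1) _ this(2)]
  have "rps_list (take n xs) = (if 1 \<in> set (take n xs) then 1 else 0)"
    by simp
  moreover have "1 \<in> set (take n xs) \<longleftrightarrow> (\<exists>i<n. xs ! i = 1)"
    unfolding take_nth_set[OF len] by (metis image_iff lessThan_iff)
  ultimately have m: "rps_list (take n xs) = (if \<exists>i<n. xs ! i = 1 then 1 else 0)"
    by simp
  have no: "\<not> (\<exists>k<n. xs ! (n + k) = rot (xs ! k) \<and>
        (\<forall>i<n. i \<noteq> k \<longrightarrow> xs ! k = rot (xs ! i) \<and> xs ! (n + i) = xs ! i))"
  proof
    assume "\<exists>k<n. xs ! (n + k) = rot (xs ! k) \<and>
        (\<forall>i<n. i \<noteq> k \<longrightarrow> xs ! k = rot (xs ! i) \<and> xs ! (n + i) = xs ! i)"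
    then obtain k where k: "k < n" "xs ! (n + k) = rot (xs ! k)"
      "\<And>i. i < n \<Longrightarrow> i \<noteq> k \<Longrightarrow> xs ! k = rot (xs ! i)" by blast
    obtain i where i: "i < n" "i \<noteq> k"
      using other_index[OF n] by blast
    show False
      using k(2) k(3)[OF i] b[OF k(1)] b[OF i(1)] by auto
  qed
  have c: "(\<forall>i<n. \<forall>j<n. xs ! (n + j) = rot (xs ! i)) \<longleftrightarrow>
      (\<forall>i<n. xs ! i = 0) \<and> (\<forall>j<n. xs ! (n + j) = 1)"
  proof -
    have "xs ! (n + j) = rot (xs ! i) \<longleftrightarrow> xs ! i = 0 \<and> xs ! (n + j) = 1" if "i < n" "j < n" for i j
      using b(1)[OF that(1)] b(2)[OF that(2)] by auto
    then have "(\<forall>i<n. \<forall>j<n. xs ! (n + j) = rot (xs ! i)) \<longleftrightarrow>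
        (\<forall>i<n. \<forall>j<n. xs ! i = 0 \<and> xs ! (n + j) = 1)"
      by blast
    also have "\<dots> \<longleftrightarrow> (\<forall>i<n. xs ! i = 0) \<and> (\<forall>j<n. xs ! (n + j) = 1)"
      using other_index[OF n] by blast
    finally show ?thesis .
  qed
  have v: "(\<exists>j<n. xs ! (n + j) = 0) \<longleftrightarrow> \<not> (\<forall>j<n. xs ! (n + j) = 1)"
    using b(2) by force
  have w: "(\<exists>i<n. xs ! i = 1) \<longleftrightarrow> \<not> (\<forall>i<n. xs ! i = 0)"
    using b(1) by force
  show ?thesis
    unfolding spike_def Let_def if_not_P[OF no] c m v w by simp
qed

text \<open>Serves to trace an output back to the arguments that carry it: some \<open>w\<close>,
  all \<open>v\<close>, or all \<open>w\<close> and \<open>v\<close> away from the peak. Hence the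
  cases are phrased by the value and not by \<open>a\<close>.\<close>

lemma spike_cases:
  assumes n: "2 \<le> n" and xs: "xs \<in> nlists (2 * n) three"
  obtains
    (plain) i where "i < n" "spike n xs = xs ! i" "spike n xs = rps_list (take n xs)"
  | (flat) "\<forall>i<n. \<forall>j<n. xs ! (n + j) = spike n xs \<and> spike n xs = rot (xs ! i)"
  | (peak) k where "k < n" "xs ! k = rot (spike n xs)" "xs ! (n + k) = rot (xs ! k)"
      "\<forall>i<n. i \<noteq> k \<longrightarrow> xs ! i = spike n xs \<and> xs ! (n + i) = spike n xs"
proof -
  have t: "xs ! i \<in> three" "xs ! (n + i) \<in> three" if "i < n" for i
    using xs that nlistsE_nth_in[OF xs, of i] nlistsE_nth_in[OF xs, of "n + i"] by (simp_all del: insert_iff)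
  have len: "n \<le> length xs" using xs by (simp add: nlists_iff)
  have ne: "take n xs \<noteq> []" "set (take n xs) \<subseteq> three"
    using n xs set_take_subset[of n xs] by (auto simp: nlists_iff)
  obtain i0 where i0: "i0 < n" "rps_list (take n xs) = xs ! i0"
    using rps_list_in[OF ne(1)] take_nth_set[OF len] by auto
  show ?thesis
  proof (cases "\<forall>i<n. \<forall>j<n. xs ! (n + j) = rot (xs ! i)")
    case True
    then have s: "spike n xs = rot (xs ! i0)"
      unfolding spike_def Let_def by (simp only: if_P[OF True] i0)
    show ?thesis
    proof (rule flat, intro allI impI conjI)
      fix i j assume ij: "i < n" "j < n"
      have "rot (xs ! i) = rot (xs ! i0)" "xs ! (n + j) = rot (xs ! i0)"
        using True[rule_format, OF ij(1), of 0] True[rule_format, OF i0(1), of 0]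
          True[rule_format, OF i0(1) ij(2)] n by auto
      then show "xs ! (n + j) = spike n xs" "spike n xs = rot (xs ! i)"
        using s by auto
    qed
  next
    case no: False
    show ?thesis
    proof (cases "\<exists>k<n. xs ! (n + k) = rot (xs ! k) \<and>
        (\<forall>i<n. i \<noteq> k \<longrightarrow> xs ! k = rot (xs ! i) \<and> xs ! (n + i) = xs ! i)")
      case True
      then obtain k where k: "k < n" "xs ! (n + k) = rot (xs ! k)"
        "\<And>i. i < n \<Longrightarrow> i \<noteq> k \<Longrightarrow> xs ! k = rot (xs ! i) \<and> xs ! (n + i) = xs ! i" by blast
      obtain i where i: "i < n" "i \<noteq> k"
        using other_index[OF n] by blast
      define a where "a = xs ! i"
      have a: "a \<in> three" "xs ! k = rot a" using k i t by (auto simp: a_def)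
      have others: "xs ! j = a" if "j < n" "j \<noteq> k" for j
        using k(3)[OF that] a t(1)[OF that(1)] rot_inj[of a "xs ! j"] by simp
      have "set (take n xs) \<subseteq> {a, rot a}" "rot a \<in> set (take n xs)"
        unfolding take_nth_set[OF len] using others a(2) k(1)
        by (blast, metis image_eqI lessThan_iff)
      then have "rps_list (take n xs) = rot a"
        using rps_list_two[OF ne(1) a(1)] by simp
      then have s: "spike n xs = a"
        using a(1) unfolding spike_def Let_def if_not_P[OF no] if_P[OF True] by auto
      show ?thesis
        by (rule peak[OF k(1)]) (use k a others s in auto)
    next
      case False
      then have "spike n xs = rps_list (take n xs)"
        unfolding spike_def Let_def if_not_P[OF no] by (rule if_not_P)
      then show ?thesis
        using plain i0 by simp
    qed
  qed
qed

text \<open>The second exception for \<open>a = 0\<close>, which is the pattern of the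
  \<open>Inr\<close> rows in \<open>spike_incompatible\<close>.\<close>

lemma spike_peak:
  assumes n: "2 \<le> n" and k: "k < n" and xs: "xs \<in> nlists (2 * n) three"
    and "xs ! k = 1" "xs ! (n + k) = 2"
    and "\<And>i. i < n \<Longrightarrow> i \<noteq> k \<Longrightarrow> xs ! i = 0 \<and> xs ! (n + i) = 0"
  shows "spike n xs = 0"
proof -
  have len: "n \<le> length xs" using xs by (simp add: nlists_iff)
  have "take n xs \<noteq> []" using n xs by (auto simp: nlists_iff)
  moreover have "xs ! i = (if i = k then 1 else 0)" if "i < n" for i
    using assms that by simp
  then have "set (take n xs) = (\<lambda>i. if i = k then 1 else 0) ` {..<n}"
    unfolding take_nth_set[OF len] by (intro image_cong) simp_all
  then have "set (take n xs) \<subseteq> {0, rot 0}" "rot 0 \<in> set (take n xs)"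
    using k by auto
  ultimately have m: "rps_list (take n xs) = 1"
    using rps_list_two[of "take n xs" 0] by simp
  have "xs ! (n + k) \<noteq> rot (xs ! i)" if "i < n" "i \<noteq> k" for i
    using assms that by simp
  moreover obtain i where "i < n" "i \<noteq> k"
    using other_index[OF n] by blast
  ultimately have no: "\<not> (\<forall>i<n. \<forall>j<n. xs ! (n + j) = rot (xs ! i))"
    using k by blast
  have yes: "\<exists>k<n. xs ! (n + k) = rot (xs ! k) \<and>
        (\<forall>i<n. i \<noteq> k \<longrightarrow> xs ! k = rot (xs ! i) \<and> xs ! (n + i) = xs ! i)"
    using assms by (intro exI[of _ k]) auto
  show ?thesis
    unfolding spike_def Let_def m if_not_P[OF no] if_P[OF yes] by simp
qed

text \<open>
  Tuples of length \<open>2n\<close>, with \<open>n\<close> coordinates \<open>Inl i\<close> restricted to \<open>{0, 1}\<close> and \<open>n\<close> coordinates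
  \<open>Inr j\<close>; coordinates with index \<open>\<ge> n\<close> are irrelevant. The value \<open>2\<close> at \<open>Inr j\<close> is guarded by the
  coordinates \<open>Inl i\<close> with \<open>i \<noteq> j\<close>, and the zero tuple is excluded.
\<close>

definition guarded :: "nat \<Rightarrow> (nat + nat \<Rightarrow> nat) set" where
  "guarded n = {x. (\<forall>c. x c \<in> three) \<and> (\<forall>i<n. x (Inl i) \<in> {0, 1}) \<and>
     (\<forall>i<n. \<forall>j<n. i \<noteq> j \<longrightarrow> x (Inr j) = 2 \<longrightarrow> x (Inl i) = 1) \<and>
     (\<exists>i<n. x (Inl i) \<noteq> 0 \<or> x (Inr i) \<noteq> 0)}"

lemma guardedD:
  assumes "x \<in> guarded n"
  shows "x c \<in> three" "i < n \<Longrightarrow> x (Inl i) \<in> {0, 1}"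
    "i < n \<Longrightarrow> j < n \<Longrightarrow> i \<noteq> j \<Longrightarrow> x (Inr j) = 2 \<Longrightarrow> x (Inl i) = 1"
    "\<exists>i<n. x (Inl i) \<noteq> 0 \<or> x (Inr i) \<noteq> 0"
  using assms unfolding guarded_def by blast+

section \<open>Invariance of the guarded relations\<close>

text \<open>On \<open>{0, 1}\<close> the operation is disjunction, and an output \<open>2\<close>
  occurs in an argument, so the guards survive. If the output were zero, both arguments would vanish
  on the left; the guards then exclude \<open>2\<close> on the right, as \<open>n \<ge> 2\<close>,
  and disjunction makes both arguments zero.\<close>

lemma rps_compatible:
  assumes n: "2 \<le> n"
  shows "compatible rps_op (guarded n)"
  unfolding compatible_def
proof
  fix gs assume "gs \<in> nlists (arity rps_op) (guarded n)"
  then have "gs \<in> nlists 2 (guarded n)" by (simp add: rps_op_def)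
  then obtain x y where gs: "gs = [x, y]" and x: "x \<in> guarded n" and y: "y \<in> guarded n"
    by (rule nlists_2E)
  note X = guardedD[OF x] and Y = guardedD[OF y]
  have "(\<lambda>c. app rps_op (map (\<lambda>g. g c) gs)) = (\<lambda>c. rps (x c) (y c))"
    using X(1) Y(1) by (simp only: gs list.map app_rps_op)
  moreover have "(\<lambda>c. rps (x c) (y c)) \<in> guarded n"
    unfolding guarded_def
  proof (intro CollectI conjI allI impI)
    show "rps (x c) (y c) \<in> three" for c
      using X(1) Y(1) by (rule rps_three)
    have lr: "rps (x (Inl i)) (y (Inl i)) = (if x (Inl i) = 0 \<and> y (Inl i) = 0 then 0 else 1)"
      if "i < n" for i
      using X(2)[OF that] Y(2)[OF that] by (auto simp: rps_def)
    show "rps (x (Inl i)) (y (Inl i)) \<in> {0, 1}" if "i < n" for i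
      using lr[OF that] by simp
    show "rps (x (Inl i)) (y (Inl i)) = 1"
      if "i < n" "j < n" "i \<noteq> j" "rps (x (Inr j)) (y (Inr j)) = 2" for i j
    proof -
      have "x (Inr j) = 2 \<or> y (Inr j) = 2"
        using that(4) by (auto simp: rps_def split: if_splits)
      then have "x (Inl i) = 1 \<or> y (Inl i) = 1"
        using X(3)[OF that(1-3)] Y(3)[OF that(1-3)] by blast
      then show ?thesis
        using lr[OF that(1)] by auto
    qed
    show "\<exists>i<n. rps (x (Inl i)) (y (Inl i)) \<noteq> 0 \<or> rps (x (Inr i)) (y (Inr i)) \<noteq> 0"
    proof (rule ccontr)
      assume "\<not> ?thesis"
      then have z: "rps (x (Inl i)) (y (Inl i)) = 0" "rps (x (Inr i)) (y (Inr i)) = 0"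
        if "i < n" for i using that by blast+
      have l: "x (Inl i) = 0 \<and> y (Inl i) = 0" if "i < n" for i
        using z(1)[OF that] lr[OF that] by (auto split: if_splits)
      have "x (Inr j) \<noteq> 2 \<and> y (Inr j) \<noteq> 2" if "j < n" for j
      proof -
        obtain i where i: "i < n" "i \<noteq> j" using other_index[OF n] by blast
        show ?thesis
          using X(3)[OF i(1) that i(2)] Y(3)[OF i(1) that i(2)] l[OF i(1)] by auto
      qed
      then have r: "x (Inr j) = 0" if "j < n" for j
        using z(2)[OF that] X(1)[of "Inr j"] Y(1)[of "Inr j"] that
        by (auto simp: rps_def split: if_splits)
      obtain i where "i < n" "x (Inl i) \<noteq> 0 \<or> x (Inr i) \<noteq> 0"
        using X(4) by blast
      then show False
        using l r by simp
    qed
  qed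
  ultimately show "(\<lambda>c. app rps_op (map (\<lambda>g. g c) gs)) \<in> guarded n"
    by simp
qed

text \<open>By \<open>spike_cases\<close>, an output \<open>2\<close> at \<open>Inr j\<close> comes
  from some \<open>w k\<close> or from all \<open>v k\<close> with \<open>2\<close> there; the
  guards make these \<open>1\<close> at \<open>Inl i\<close>, and so is the output by
  \<open>spike_bool\<close>. If the output were zero, each \<open>w k\<close> would be the spike at
  a coordinate of its own, and for \<open>m < n\<close> some \<open>Inl i\<close> would be left over
  at which all \<open>v k\<close> are \<open>1\<close>.\<close>

lemma spike_compatible:
  assumes m: "2 \<le> m" and n: "2 \<le> n" and mn: "m \<noteq> n"
  shows "compatible (spike_op m) (guarded n)"
  unfolding compatible_def
proof
  fix gs assume "gs \<in> nlists (arity (spike_op m)) (guarded n)"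
  then have gs: "gs \<in> nlists (2 * m) (guarded n)" by (simp add: spike_op_def)
  define w v where "w k = gs ! k" and "v k = gs ! (m + k)" for k
  define row where "row c = map (\<lambda>g. g c) gs" for c
  define r where "r c = spike m (row c)" for c
  have wv: "w k \<in> guarded n" "v k \<in> guarded n" if "k < m" for k
    using nlistsE_nth_in[OF gs, of k] nlistsE_nth_in[OF gs, of "m + k"] that
    by (simp_all add: w_def v_def)
  have row_nth: "row c ! k = w k c" "row c ! (m + k) = v k c" if "k < m" for c k
    using that gs by (simp_all add: row_def w_def v_def nlistsE_length)
  have row3: "row c \<in> nlists (2 * m) three" for c
    unfolding row_def by (rule row_nlists[OF gs guardedD(1)])
  have take_row: "set (take m (row c)) = (\<lambda>k. w k c) ` {..<m}" for c
    using row3[of c] row_nth(1)[of _ c] by (simp add: take_nth_set nlistsE_length)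
  have bool_row: "row (Inl i) \<in> nlists (2 * m) {0, 1}" if "i < n" for i
    unfolding row_def by (rule row_nlists[OF gs guardedD(2)[OF _ that]])
  have rl: "r (Inl i) = (if (\<forall>k<m. w k (Inl i) = 0) \<and> (\<exists>k<m. v k (Inl i) = 0) then 0 else 1)"
    if "i < n" for i
    unfolding r_def spike_bool[OF m bool_row[OF that]] using row_nth by (simp cong: conj_cong)
  have r: "r \<in> guarded n"
    unfolding guarded_def
  proof (intro CollectI conjI allI impI)
    show "r c \<in> three" for c
      unfolding r_def using m row3 by (intro spike_in) auto
    show "r (Inl i) \<in> {0, 1}" if "i < n" for i
      using rl[OF that] by simp
    show "r (Inl i) = 1" if i: "i < n" and j: "j < n" and ij: "i \<noteq> j" and 2: "r (Inr j) = 2" for i j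
    proof -
      have up: "w k (Inr j) = 2 \<Longrightarrow> w k (Inl i) = 1" "v k (Inr j) = 2 \<Longrightarrow> v k (Inl i) = 1"
        if "k < m" for k
        using guardedD(3)[OF wv(1)[OF that] i j ij] guardedD(3)[OF wv(2)[OF that] i j ij] by blast+
      have s: "spike m (row (Inr j)) = 2" using 2 by (simp add: r_def)
      from m row3 show ?thesis
      proof (cases rule: spike_cases[of m "row (Inr j)"])
        case (plain k)
        then have "w k (Inl i) = 1" using s up row_nth by simp
        then show ?thesis using rl[OF i] plain(1) by auto
      next
        case flat
        then have "v k (Inl i) = 1" if "k < m" for k using s up row_nth that by simp
        then show ?thesis using rl[OF i] by auto
      next
        case (peak k)
        obtain l where l: "l < m" "l \<noteq> k" using other_index[OF m] by blast
        then have "w l (Inl i) = 1" using peak s up row_nth by simp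
        then show ?thesis using rl[OF i] l(1) by auto
      qed
    qed
    show "\<exists>i<n. r (Inl i) \<noteq> 0 \<or> r (Inr i) \<noteq> 0"
    proof (rule ccontr)
      assume "\<not> ?thesis"
      then have z: "r (Inl i) = 0" "r (Inr i) = 0" if "i < n" for i using that by blast+
      have w0: "w k (Inl i) = 0" if "i < n" "k < m" for i k
        using z(1)[OF that(1)] rl[OF that(1)] that(2) by (auto split: if_splits)
      have v0: "\<exists>k<m. v k (Inl i) = 0" if "i < n" for i
        using z(1)[OF that] rl[OF that] by (auto split: if_splits)
      \<comment> \<open>A value \<open>2\<close> would be guarded by some \<open>Inl i\<close>,
        where \<open>w k\<close> vanishes.\<close>
      have w2: "w k (Inr j) \<in> {0, 1}" if "j < n" "k < m" for j k
      proof -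
        obtain i where i: "i < n" "i \<noteq> j" using other_index[OF n] by blast
        show ?thesis
          using guardedD(3)[OF wv(1)[OF that(2)] i(1) that(1) i(2)] w0[OF i(1) that(2)]
            guardedD(1)[OF wv(1)[OF that(2)], of "Inr j"] by auto
      qed
      have "\<exists>j<n. w k (Inr j) = 1 \<and> v k (Inr j) = 2 \<and> (\<forall>l<m. l \<noteq> k \<longrightarrow> w l (Inr j) = 0)"
        if k: "k < m" for k
      proof -
        obtain j where j: "j < n" "w k (Inr j) \<noteq> 0"
          using guardedD(4)[OF wv(1)[OF k]] w0[OF _ k] by auto
        then have wk: "w k (Inr j) = 1" using w2[OF j(1) k] by simp
        have s: "spike m (row (Inr j)) = 0" using z(2)[OF j(1)] by (simp add: r_def)
        \<comment> \<open>With a \<open>1\<close> among the \<open>w\<close>, the maximum is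
          \<open>1\<close> and the flat case gives \<open>2\<close>, so the output \<open>0\<close>
          must be a peak; it sits at \<open>k\<close>, all other \<open>w\<close> being
          \<open>0\<close>.\<close>
        from m row3 show ?thesis
        proof (cases rule: spike_cases[of m "row (Inr j)"])
          case (plain l)
          have "take m (row (Inr j)) \<noteq> []"
            using m row3[of "Inr j"] by (auto simp: nlists_iff)
          moreover have "set (take m (row (Inr j))) \<subseteq> {0, rot 0}"
            unfolding take_row rot_simps by (rule image_subsetI) (use w2[OF j(1)] in simp)
          moreover have "rot 0 \<in> set (take m (row (Inr j)))"
            using wk k unfolding take_row by (intro image_eqI[of _ _ k]) auto
          ultimately have "rps_list (take m (row (Inr j))) = 1"
            using rps_list_two[of "take m (row (Inr j))" 0] by simp
          then show ?thesis using plain s by simp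
        next
          case flat
          then have "rot (w k (Inr j)) = 0"
            using flat k s row_nth by metis
          then show ?thesis using wk by simp
        next
          case (peak l)
          have "l = k"
            using peak(4) k s row_nth(1)[OF k] wk by force
          then show ?thesis
            using peak s row_nth j(1) wk by (intro exI[of _ j]) auto
        qed
      qed
      \<comment> \<open>\<open>P\<close> sends each \<open>w k\<close> to a coordinate where it is the spike. It is injective, so \<open>m < n\<close>, and
        a coordinate \<open>Inl i\<close> with \<open>i\<close> outside its range is then guarded in every \<open>v k\<close>.\<close>
      then obtain P where P: "\<And>k. k < m \<Longrightarrow> P k < n" "\<And>k. k < m \<Longrightarrow> w k (Inr (P k)) = 1"
          "\<And>k. k < m \<Longrightarrow> v k (Inr (P k)) = 2"
          "\<And>k l. k < m \<Longrightarrow> l < m \<Longrightarrow> l \<noteq> k \<Longrightarrow> w l (Inr (P k)) = 0"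
        by metis
      have "inj_on P {..<m}"
        using P(2,4) by (intro inj_onI) (metis lessThan_iff zero_neq_one)
      then have "card (P ` {..<m}) = m" by (simp add: card_image)
      moreover have sub: "P ` {..<m} \<subseteq> {..<n}" using P(1) by auto
      ultimately have "P ` {..<m} \<noteq> {..<n}" using mn by force
      then obtain i where i: "i < n" "i \<notin> P ` {..<m}" using sub by blast
      have "v k (Inl i) = 1" if "k < m" for k
        using guardedD(3)[OF wv(2)[OF that] i(1) P(1)[OF that] _ P(3)[OF that]] i(2) that by auto
      then show False using v0[OF i(1)] by auto
    qed
  qed
  have "app (spike_op m) (map (\<lambda>g. g c) gs) = r c" for c
    using row3[of c] unfolding r_def row_def by (simp add: spike_op_def)
  then show "(\<lambda>c. app (spike_op m) (map (\<lambda>g. g c) gs)) \<in> guarded n"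
    using r by simp
qed

text \<open>Let \<open>w k\<close> be the unit tuple at \<open>Inr k\<close>, and let
  \<open>v k\<close> have \<open>2\<close> at \<open>Inr k\<close> and just the guards that this
  requires. At \<open>Inl i\<close> all \<open>w\<close> and \<open>v i\<close> are
  \<open>0\<close>; at \<open>Inr j\<close> there is a peak at \<open>j\<close>. So the output is
  the excluded zero tuple.\<close>

lemma spike_incompatible:
  assumes n: "2 \<le> n"
  shows "\<not> compatible (spike_op n) (guarded n)"
proof
  assume c: "compatible (spike_op n) (guarded n)"
  define w v :: "nat \<Rightarrow> nat + nat \<Rightarrow> nat"
    where "w k c = (case c of Inl i \<Rightarrow> 0 | Inr j \<Rightarrow> if j = k then 1 else 0)"
      and "v k c = (case c of Inl i \<Rightarrow> if i = k then 0 else 1 | Inr j \<Rightarrow> if j = k then 2 else 0)" for k c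
  define gs where "gs = map w [0..<n] @ map v [0..<n]"
  define row where "row c = map (\<lambda>g. g c) gs" for c
  have "w k \<in> guarded n" "v k \<in> guarded n" if "k < n" for k
    using that by (auto simp: guarded_def w_def v_def split: sum.splits)
  then have gs: "gs \<in> nlists (2 * n) (guarded n)"
    by (auto simp: gs_def nlists_iff)
  have row_nth: "row c ! k = w k c" "row c ! (n + k) = v k c" if "k < n" for c k
    using that by (simp_all add: row_def gs_def nth_append)
  have row3: "row c \<in> nlists (2 * n) three" for c
    unfolding row_def by (rule row_nlists[OF gs guardedD(1)])
  have "(\<lambda>c. app (spike_op n) (row c)) \<in> guarded n"
    using c gs unfolding compatible_def row_def by (simp add: spike_op_def)
  then have r: "(\<lambda>c. spike n (row c)) \<in> guarded n"
    using row3 by (simp add: spike_op_def)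
  have t: "spike n (row (Inl i)) = 0" if i: "i < n" for i
  proof -
    have "row (Inl i) \<in> nlists (2 * n) {0, 1}"
      using i by (auto simp: row_def gs_def w_def v_def nlists_iff)
    moreover have "\<forall>k<n. row (Inl i) ! k = 0" "row (Inl i) ! (n + i) = 0"
      using i by (simp_all add: row_nth w_def v_def)
    ultimately show ?thesis
      using i by (simp add: spike_bool[OF n]) blast
  qed
  have a: "spike n (row (Inr j)) = 0" if j: "j < n" for j
    by (rule spike_peak[OF n j row3]) (use j in \<open>simp_all add: row_nth w_def v_def\<close>)
  obtain i where "i < n" "spike n (row (Inl i)) \<noteq> 0 \<or> spike n (row (Inr i)) \<noteq> 0"
    using guardedD(4)[OF r] by blast
  then show False
    using t a by simp
qed

section \<open>Homomorphisms that fix the cyclic maximum\<close>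

definition idempotent :: "nat operation \<Rightarrow> bool" where
  "idempotent f \<longleftrightarrow> (\<forall>x\<in>three. app f (replicate (arity f) x) = x)"

definition rps3 :: "nat operation \<Rightarrow> nat operation \<Rightarrow> nat operation" where
  "rps3 f g = comp_op three 3 rps_op [f, g]"

lemma app_rps3:
  assumes "f \<in> operations three" "g \<in> operations three" "arity f = 3" "arity g = 3"
    and "xs \<in> nlists 3 three"
  shows "app (rps3 f g) xs = rps (app f xs) (app g xs)"
proof -
  have "app f xs \<in> three" "app g xs \<in> three"
    using assms app_closed[of f three xs] app_closed[of g three xs] by simp_all
  then show ?thesis
    by (simp only: rps3_def app_comp_op[OF assms(5)] list.map app_rps_op)
qed

lemma rps3_operation:
  assumes "f \<in> operations three" "g \<in> operations three" "arity f = 3" "arity g = 3"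
  shows "rps3 f g \<in> operations three"
  unfolding rps3_def using assms rps_operation
  by (intro comp_operation) (auto simp: composable_def)

lemma arity_rps3 [simp]: "arity (rps3 f g) = 3"
  by (simp add: rps3_def)

text \<open>Meant for the set \<open>T\<close> of ternary operations fixed by a homomorphism: the
  identity \<open>F(us) = v\<close> carries over to the image of \<open>F\<close>, and evaluating it
  at \<open>(0, 1, 2)\<close>, which \<open>us\<close> fixes, recovers the value of that image
  there.\<close>

lemma ternary_reduction:
  assumes F: "self_dual F" "arity F = 3" "idempotent F"
    and T: "\<And>i. i < 3 \<Longrightarrow> proj three 3 i \<in> T" "\<And>f g. f \<in> T \<Longrightarrow> g \<in> T \<Longrightarrow> rps3 f g \<in> T"
  obtains us v where "us \<in> lists T" "length us = 3" "v \<in> T" "comp_op three 3 F us = v"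
    "\<forall>u\<in>set us. arity u = 3"
    "map (\<lambda>u. app u [0, 1, 2]) us = [0, 1, 2]" "app v [0, 1, 2] = app F [0, 1, 2]"
proof -
  note goal = that
  define p where "p i = proj three 3 i" for i
  \<comment> \<open>Among three distinct elements the winner of two loses to the third, so
    \<open>X\<close>, \<open>Y\<close>, \<open>Z\<close> return the arguments of a triple without
    repetition. On other triples all three return the maximum of the at most two values.\<close>
  define X where "X = rps3 (rps3 (p 1) (p 2)) (p 0)"
  define Y where "Y = rps3 (rps3 (p 2) (p 0)) (p 1)"
  define Z where "Z = rps3 (rps3 (p 0) (p 1)) (p 2)"
  \<comment> \<open>Each entry plays against its cyclic predecessor: an ascending triple stays, and
    in a descending one every entry goes up by one. The third level repeats this.\<close>
  define X1 where "X1 = rps3 X Z"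
  define Y1 where "Y1 = rps3 X Y"
  define Z1 where "Z1 = rps3 Y Z"
  define X2 where "X2 = rps3 X1 Z1"
  define Y2 where "Y2 = rps3 X1 Y1"
  define Z2 where "Z2 = rps3 Y1 Z1"
  note defs = X_def Y_def Z_def X1_def Y1_def Z1_def X2_def Y2_def Z2_def
  have p: "p i \<in> operations three" "arity (p i) = 3" "p i \<in> T" if "i < 3" for i
    using that T(1) by (auto simp: p_def intro: proj_operation)
  have inT: "X \<in> T" "Y \<in> T" "Z \<in> T" "X1 \<in> T" "Y1 \<in> T" "Z1 \<in> T" "X2 \<in> T" "Y2 \<in> T" "Z2 \<in> T"
    unfolding defs by (intro T(2) p(3); simp)+
  have ar: "arity X = 3" "arity Y = 3" "arity Z = 3" "arity X1 = 3" "arity Y1 = 3" "arity Z1 = 3"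
      "arity X2 = 3" "arity Y2 = 3" "arity Z2 = 3"
    by (simp_all add: defs)
  have op: "X \<in> operations three" "Y \<in> operations three" "Z \<in> operations three"
    "X1 \<in> operations three" "Y1 \<in> operations three" "Z1 \<in> operations three"
    "X2 \<in> operations three" "Y2 \<in> operations three" "Z2 \<in> operations three"
    unfolding defs by (intro rps3_operation p; simp add: p(2))+
  have ap: "app (p 0) [a, b, c] = a" "app (p 1) [a, b, c] = b" "app (p 2) [a, b, c] = c"
    if "[a, b, c] \<in> nlists 3 three" for a b c
    using that by (simp_all add: p_def app_proj)
  have e0: "app X [a, b, c] = rps (rps b c) a" "app Y [a, b, c] = rps (rps c a) b"
      "app Z [a, b, c] = rps (rps a b) c"
    if "[a, b, c] \<in> nlists 3 three" for a b c
    unfolding X_def Y_def Z_def using that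
    by (simp_all add: app_rps3 rps3_operation p ap del: insert_iff One_nat_def)
  have e1: "app X1 xs = rps (app X xs) (app Z xs)" "app Y1 xs = rps (app X xs) (app Y xs)"
    "app Z1 xs = rps (app Y xs) (app Z xs)" "app X2 xs = rps (app X1 xs) (app Z1 xs)"
    "app Y2 xs = rps (app X1 xs) (app Y1 xs)" "app Z2 xs = rps (app Y1 xs) (app Z1 xs)"
    if "xs \<in> nlists 3 three" for xs
    using app_rps3[OF op(1,3) ar(1,3) that] app_rps3[OF op(1,2) ar(1,2) that]
      app_rps3[OF op(2,3) ar(2,3) that] app_rps3[OF op(4,6) ar(4,6) that]
      app_rps3[OF op(4,5) ar(4,5) that] app_rps3[OF op(5,6) ar(5,6) that]
    unfolding X1_def[symmetric] Y1_def[symmetric] Z1_def[symmetric]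
      X2_def[symmetric] Y2_def[symmetric] Z2_def[symmetric]
    by simp_all
  have in3: "[a, b, c] \<in> nlists 3 three" if "a \<in> three" "b \<in> three" "c \<in> three" for a b c
    using that by (simp add: nlists_iff del: insert_iff)
  have const: "app X [a, b, c] = rps (rps b c) a" "app Y [a, b, c] = rps (rps b c) a"
      "app Z [a, b, c] = rps (rps b c) a" "rps (rps b c) a \<in> three"
    if "a \<in> three" "b \<in> three" "c \<in> three" "\<not> distinct [a, b, c]" for a b c
    unfolding e0[OF in3[OF that(1-3)]] using that by (auto simp: rps_table)
  have inj: "app X [a, b, c] = a" "app Y [a, b, c] = b" "app Z [a, b, c] = c"
    if "a \<in> three" "b \<in> three" "c \<in> three" "distinct [a, b, c]" for a b c
    unfolding e0[OF in3[OF that(1-3)]] using that by (auto simp: rps_table)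
  have idem: "app F [a, a, a] = a" if "a \<in> three" for a
    using bspec[OF F(3)[unfolded idempotent_def] that] F(2) by (simp add: numeral_3_eq_3)
  \<comment> \<open>By self-duality and idempotence, \<open>F\<close> matters only through its values at \<open>(0, 1, 2)\<close> and
    \<open>(0, 2, 1)\<close>. The triples \<open>(X, Y, Z)\<close>, \<open>(X1, Y1, Z1)\<close>, \<open>(X2, Y2, Z2)\<close> fix the former and add
    \<open>0\<close>, \<open>1\<close>, \<open>2\<close> to the latter; one of them brings the second value to that of the term among
    \<open>X\<close>, \<open>Y\<close>, \<open>Z\<close> selected by the first.\<close>
  define P where "P = app F [0, 1, 2]"
  define N where "N = app F [0, 2, 1]"
  have PN: "P \<in> three" "N \<in> three"
    unfolding P_def N_def using F(1,2) in3[of 0 1 2] in3[of 0 2 1]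
      app_closed[of F three "[0, 1, 2]"] app_closed[of F three "[0, 2, 1]"]
    by (simp_all add: self_dual_iff)
  have rot: "app F [rot a, rot b, rot c] = rot (app F [a, b, c])"
    if "a \<in> three" "b \<in> three" "c \<in> three" for a b c
  proof -
    have "app F (map rot [a, b, c]) = rot (app F [a, b, c])"
      using F(1)[unfolded self_dual_iff, THEN conjunct2] F(2) in3[OF that] by (metis (no_types))
    then show ?thesis by simp
  qed
  have vals: "app F [0, 1, 2] = P" "app F [1, 2, 0] = rot P" "app F [2, 0, 1] = rot (rot P)"
    "app F [0, 2, 1] = N" "app F [1, 0, 2] = rot N" "app F [2, 1, 0] = rot (rot N)"
    using rot[of 0 1 2] rot[of 1 2 0] rot[of 0 2 1] rot[of 1 0 2] by (simp_all add: P_def N_def)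
  \<comment> \<open>Agreement on the six triples without repetition suffices: elsewhere all terms
    take a common value, which the idempotent \<open>F\<close> returns.\<close>
  have main: "thesis"
    if U: "u1 \<in> {X, X1, X2}" "u2 \<in> {Y, Y1, Y2}" "u3 \<in> {Z, Z1, Z2}" and v: "v \<in> {X, Y, Z}"
      and val: "app v [0, 1, 2] = P"
      and eq: "\<forall>xs\<in>{[0, 1, 2], [1, 2, 0], [2, 0, 1], [0, 2, 1], [1, 0, 2], [2, 1, 0]}.
        app F [app u1 xs, app u2 xs, app u3 xs] = app v xs"
    for u1 u2 u3 v
  proof (rule goal[of "[u1, u2, u3]" v])
    have i012: "[0, 1, 2] \<in> nlists 3 three" by (intro in3) simp_all
    have u: "u1 \<in> T" "u2 \<in> T" "u3 \<in> T" "arity u1 = 3" "arity u2 = 3" "arity u3 = 3"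
      "u1 \<in> operations three" "u2 \<in> operations three" "u3 \<in> operations three"
      using U inT ar op by blast+
    show "[u1, u2, u3] \<in> lists T" "length [u1, u2, u3] = 3" "\<forall>u\<in>set [u1, u2, u3]. arity u = 3"
      using u by simp_all
    show "v \<in> T" using v inT by blast
    show "app v [0, 1, 2] = app F [0, 1, 2]" using val by (simp add: P_def)
    show "map (\<lambda>u. app u [0, 1, 2]) [u1, u2, u3] = [0, 1, 2]"
      using U by (auto simp: e1[OF i012] inj rps_table simp del: One_nat_def)
    show "comp_op three 3 F [u1, u2, u3] = v"
    proof (rule operation_eqI)
      show "comp_op three 3 F [u1, u2, u3] \<in> operations three"
        using F(1,2) u by (intro comp_operation) (simp_all add: self_dual_iff composable_def)
      show "v \<in> operations three" "arity (comp_op three 3 F [u1, u2, u3]) = arity v"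
        using v op ar by auto
      fix xs assume "xs \<in> nlists (arity (comp_op three 3 F [u1, u2, u3])) three"
      then have "xs \<in> nlists 3 three" by simp
      then obtain a b c where xs: "xs = [a, b, c]" and abc: "a \<in> three" "b \<in> three" "c \<in> three"
        by (rule nlists_3E)
      have "app F [app u1 [a, b, c], app u2 [a, b, c], app u3 [a, b, c]] = app v [a, b, c]"
      proof (cases "distinct [a, b, c]")
        case True
        then have "[a, b, c] \<in> {[0, 1, 2], [1, 2, 0], [2, 0, 1], [0, 2, 1], [1, 0, 2], [2, 1, 0]}"
          using abc by auto
        then show ?thesis by (rule bspec[OF eq])
      next
        case False
        define m where "m = rps (rps b c) a"
        note C = const[OF abc False, folded m_def]
        have "app u1 [a, b, c] = m" "app u2 [a, b, c] = m" "app u3 [a, b, c] = m" "app v [a, b, c] = m"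
          using U v by (auto simp: e1[OF in3[OF abc]] C rps_table)
        then show ?thesis using idem[OF C(4)] by simp
      qed
      then show "app (comp_op three 3 F [u1, u2, u3]) xs = app v xs"
        by (simp only: xs app_comp_op[OF in3[OF abc]] list.map)
    qed
  qed
  have i: "[0, 1, 2] \<in> nlists 3 three" "[1, 2, 0] \<in> nlists 3 three" "[2, 0, 1] \<in> nlists 3 three"
    "[0, 2, 1] \<in> nlists 3 three" "[1, 0, 2] \<in> nlists 3 three" "[2, 1, 0] \<in> nlists 3 three"
    by (intro in3; simp)+
  have tab: "app X [0, 1, 2] = 0" "app X [1, 2, 0] = 1" "app X [2, 0, 1] = 2"
    "app X [0, 2, 1] = 0" "app X [1, 0, 2] = 1" "app X [2, 1, 0] = 2"
    "app Y [0, 1, 2] = 1" "app Y [1, 2, 0] = 2" "app Y [2, 0, 1] = 0"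
    "app Y [0, 2, 1] = 2" "app Y [1, 0, 2] = 0" "app Y [2, 1, 0] = 1"
    "app Z [0, 1, 2] = 2" "app Z [1, 2, 0] = 0" "app Z [2, 0, 1] = 1"
    "app Z [0, 2, 1] = 1" "app Z [1, 0, 2] = 2" "app Z [2, 1, 0] = 0"
    by (simp_all add: inj)
  note E = e1[OF i(1)] e1[OF i(2)] e1[OF i(3)] e1[OF i(4)] e1[OF i(5)] e1[OF i(6)]
  have "P = 0 \<or> P = 1 \<or> P = 2" "N = 0 \<or> N = 1 \<or> N = 2"
    using PN by auto
  \<comment> \<open>At \<open>(0, 2, 1)\<close> the selected term has the value \<open>- P\<close>
    modulo \<open>3\<close>, so the required shift is \<open>- (P + N)\<close>.\<close>
  then consider "P = 0" "N = 0" | "P = 0" "N = 1" | "P = 0" "N = 2"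
    | "P = 1" "N = 0" | "P = 1" "N = 1" | "P = 1" "N = 2"
    | "P = 2" "N = 0" | "P = 2" "N = 1" | "P = 2" "N = 2"
    by blast
  then show thesis
  proof cases
    case 1
    show ?thesis
      by (rule main[of X Y Z X])
        (simp_all add: tab vals E rps_table 1 del: One_nat_def)
  next
    case 2
    show ?thesis
      by (rule main[of X2 Y2 Z2 X])
        (simp_all add: tab vals E rps_table 2 del: One_nat_def)
  next
    case 3
    show ?thesis
      by (rule main[of X1 Y1 Z1 X])
        (simp_all add: tab vals E rps_table 3 del: One_nat_def)
  next
    case 4
    show ?thesis
      by (rule main[of X2 Y2 Z2 Y])
        (simp_all add: tab vals E rps_table 4 del: One_nat_def)
  next
    case 5
    show ?thesis
      by (rule main[of X1 Y1 Z1 Y])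
        (simp_all add: tab vals E rps_table 5 del: One_nat_def)
  next
    case 6
    show ?thesis
      by (rule main[of X Y Z Y])
        (simp_all add: tab vals E rps_table 6 del: One_nat_def)
  next
    case 7
    show ?thesis
      by (rule main[of X1 Y1 Z1 Z])
        (simp_all add: tab vals E rps_table 7 del: One_nat_def)
  next
    case 8
    show ?thesis
      by (rule main[of X Y Z Z])
        (simp_all add: tab vals E rps_table 8 del: One_nat_def)
  next
    case 9
    show ?thesis
      by (rule main[of X2 Y2 Z2 Z])
        (simp_all add: tab vals E rps_table 9 del: One_nat_def)
  qed
qed


text \<open>Substituting ternary projections turns \<open>app f xs\<close> into the value at
  \<open>(0, 1, 2)\<close> of a ternary \<open>F\<close> in \<open>C\<close>, and
  \<open>\<phi>\<close> respects this. By \<open>ternary_reduction\<close>, \<open>F(us) = v\<close>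
  with \<open>us\<close> and \<open>v\<close> fixed by \<open>\<phi>\<close>; so the image of
  \<open>F\<close> satisfies the same identity and has the same value at
  \<open>(0, 1, 2)\<close>.\<close>

lemma clone_hom_fixes:
  assumes C: "clone three C" "\<And>f. f \<in> C \<Longrightarrow> self_dual f \<and> idempotent f"
    and D: "D \<subseteq> operations three" and \<phi>: "clone_hom three C three D \<phi>"
    and rps: "rps_op \<in> C" "\<phi> rps_op = rps_op" and f: "f \<in> C"
  shows "\<phi> f = f"
proof -
  have opC: "g \<in> operations three" if "g \<in> C" for g
    using C(2)[OF that] by (simp add: self_dual_iff)
  have op\<phi>: "\<phi> g \<in> operations three" if "g \<in> C" for g
    using clone_homD(1)[OF \<phi> that] D by blast
  define T where "T = {g \<in> C. arity g = 3 \<and> \<phi> g = g}"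
  have projT: "proj three 3 i \<in> T" if "i < 3" for i
    using that clone_homD(3)[OF \<phi>] clone_proj[OF C(1)] by (simp add: T_def)
  have rpsT: "rps3 g h \<in> T" if "g \<in> T" "h \<in> T" for g h
  proof -
    have "composable 3 rps_op [g, h]" "[g, h] \<in> lists C"
      using that by (simp_all add: composable_def T_def)
    then show ?thesis
      using clone_comp[OF C(1) rps(1)] clone_homD(4)[OF \<phi> rps(1)] rps(2) that
      by (simp add: T_def rps3_def)
  qed
  show ?thesis
  proof (rule operation_eqI[OF op\<phi>[OF f] opC[OF f]])
    show "arity (\<phi> f) = arity f" by (rule clone_homD(2)[OF \<phi> f])
    fix xs assume "xs \<in> nlists (arity (\<phi> f)) three"
    then have xs: "xs \<in> nlists (arity f) three" by (simp add: clone_homD(2)[OF \<phi> f])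
    \<comment> \<open>An entry \<open>x\<close> doubles as the index of the projection with value
      \<open>x\<close> at \<open>(0, 1, 2)\<close>.\<close>
    define ps where "ps = map (proj three 3) xs"
    define F where "F = comp_op three 3 f ps"
    have i012: "[0, 1, 2] \<in> nlists 3 three" by (simp add: nlists_iff)
    have lt: "x < 3" if "x \<in> set xs" for x
      using xs that by (auto simp: nlists_iff)
    have ps: "ps \<in> lists C" "composable 3 f ps" "map \<phi> ps = ps"
      using xs lt projT by (auto simp: ps_def composable_def nlistsE_length T_def)
    have FC: "F \<in> C" and \<phi>F: "\<phi> F = comp_op three 3 (\<phi> f) ps"
      using clone_comp[OF C(1) f ps(1,2)] clone_homD(4)[OF \<phi> f ps(1,2)] ps(3)
      by (simp_all add: F_def)
    have "[0, 1, 2] ! x = x" if "x \<in> set xs" for x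
      using xs that by (auto simp: nlists_iff)
    then have ev: "map (\<lambda>g. app g [0, 1, 2]) ps = xs"
      unfolding ps_def map_map o_def app_proj[OF i012] by (rule map_idI)
    have "self_dual F" "arity F = 3" "idempotent F"
      using C(2)[OF FC] by (simp_all add: F_def)
    from ternary_reduction[OF this projT rpsT]
    obtain us v where us: "us \<in> lists T" "length us = 3" and v: "v \<in> T" "comp_op three 3 F us = v"
      and ar: "\<forall>u\<in>set us. arity u = 3" and u012: "map (\<lambda>u. app u [0, 1, 2]) us = [0, 1, 2]"
      and v012: "app v [0, 1, 2] = app F [0, 1, 2]"
      by blast
    have "us \<in> lists C" "composable 3 F us" "map \<phi> us = us"
      using us ar by (auto simp: T_def composable_def F_def intro!: map_idI)
    then have "comp_op three 3 (\<phi> F) us = v"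
      using clone_homD(4)[OF \<phi> FC, of us 3] v by (simp add: T_def)
    then have "app (\<phi> F) [0, 1, 2] = app v [0, 1, 2]"
      using app_comp_op[OF i012, of "\<phi> F" us] u012 by simp
    then have "app (\<phi> F) [0, 1, 2] = app F [0, 1, 2]"
      using v012 by simp
    then show "app (\<phi> f) xs = app f xs"
      unfolding \<phi>F unfolding F_def app_comp_op[OF i012] ev .
  qed
qed

section \<open>A continuum of inequivalent clones\<close>

text \<open>
  Only index sets without \<open>2\<close> are used below: preserving \<open>guarded 2\<close> forces idempotence and makes
  \<open>rps_op\<close> the only commutative binary operation.
\<close>

definition peak_clone :: "nat set \<Rightarrow> nat operation set" where
  "peak_clone S = {f. self_dual f \<and> (\<forall>n\<ge>2. n \<notin> S \<longrightarrow> compatible f (guarded n))}"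

lemma clone_peak_clone: "clone three (peak_clone S)"
  unfolding clone_def
proof (intro conjI allI ballI impI)
  show "peak_clone S \<subseteq> operations three"
    by (auto simp: peak_clone_def self_dual_iff)
  show "proj three n i \<in> peak_clone S" if "i < n" for n i
    unfolding peak_clone_def
    by (intro CollectI conjI allI impI self_dual_proj[OF that] compatible_proj[OF that])
       (rule guardedD(1))
  fix k f gs
  assume f: "f \<in> peak_clone S" and "gs \<in> lists (peak_clone S)" and c: "composable k f gs"
  then have gs: "g \<in> peak_clone S" if "g \<in> set gs" for g using that by blast
  show "comp_op three k f gs \<in> peak_clone S"
    unfolding peak_clone_def
  proof (intro CollectI conjI allI impI)
    show "self_dual (comp_op three k f gs)"
      using f gs c by (intro self_dual_comp) (auto simp: peak_clone_def)
    show "compatible (comp_op three k f gs) (guarded n)" if "2 \<le> n" "n \<notin> S" for n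
      using f gs c that by (intro compatible_comp guardedD(1)) (auto simp: peak_clone_def)
  qed
qed

lemma peak_clone_self_dual_clones: "peak_clone S \<in> self_dual_clones"
  using clone_peak_clone by (auto simp: self_dual_clones_def peak_clone_def)

section \<open>Consequences of preserving \<open>guarded 2\<close>\<close>

text \<open>The diagonal \<open>u\<close> commutes with \<open>rot\<close>, so it is a rotation. A
  tuple with both \<open>0\<close> and \<open>1\<close> on the left shows that \<open>u\<close> maps
  \<open>{0, 1}\<close> into itself, which only the identity does.\<close>

lemma idempotent_if_compatible:
  assumes f: "self_dual f" and c: "compatible f (guarded 2)"
  shows "idempotent f"
proof -
  define u where "u x = app f (replicate (arity f) x)" for x
  have u3: "u x \<in> three" if "x \<in> three" for x
    unfolding u_def using f that by (intro app_closed nlists_replicateI) (simp_all add: self_dual_iff)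
  have urot: "u (rot x) = rot (u x)" if "x \<in> three" for x
  proof -
    have "replicate (arity f) x \<in> nlists (arity f) three"
      using that by (intro nlists_replicateI)
    then show ?thesis
      using f[unfolded self_dual_iff, THEN conjunct2] unfolding u_def by (metis map_replicate)
  qed
  define g :: "nat + nat \<Rightarrow> nat" where "g c = (if c = Inl 1 then 1 else 0)" for c
  have "g \<in> guarded 2"
    by (auto simp: guarded_def g_def)
  then have "replicate (arity f) g \<in> nlists (arity f) (guarded 2)"
    by (rule nlists_replicateI)
  then have "(\<lambda>c. app f (map (\<lambda>g. g c) (replicate (arity f) g))) \<in> guarded 2"
    using c unfolding compatible_def by blast
  then have "(\<lambda>c. u (g c)) \<in> guarded 2"
    by (simp add: u_def)
  from guardedD(2)[OF this, of 0] guardedD(2)[OF this, of 1]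
  have "u 0 \<in> {0, 1}" "u 1 \<in> {0, 1}"
    by (simp_all add: g_def)
  then have "u 0 = 0"
    using urot[of 0] by auto
  moreover from this have "u 1 = 1"
    using urot[of 0] by simp
  moreover from this have "u 2 = 2"
    using urot[of 1] by simp
  ultimately show ?thesis
    unfolding idempotent_def u_def by blast
qed

text \<open>Applied to \<open>g\<close> and \<open>h\<close>, \<open>q\<close> yields its values at
  \<open>(0, 1)\<close> and \<open>(1, 0)\<close> in the two left coordinates and \<open>0\<close>
  on the right; these values are Boolean and, the zero tuple being excluded, not both
  \<open>0\<close>. Self-duality, commutativity and idempotence give the rest.\<close>

lemma rps_unique:
  assumes q: "self_dual q" "compatible q (guarded 2)" "arity q = 2"
    and comm: "app q [0, 1] = app q [1, 0]"
  shows "q = rps_op"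
proof -
  have in2: "[x, y] \<in> nlists 2 three" if "x \<in> three" "y \<in> three" for x y
    using that by (simp add: nlists_iff del: insert_iff)
  have idem: "app q [x, x] = x" if "x \<in> three" for x
    using bspec[OF idempotent_if_compatible[OF q(1,2), unfolded idempotent_def] that] q(3)
    by (simp add: numeral_2_eq_2)
  have rot: "app q [rot x, rot y] = rot (app q [x, y])" if "x \<in> three" "y \<in> three" for x y
  proof -
    have "app q (map rot [x, y]) = rot (app q [x, y])"
      using q(1)[unfolded self_dual_iff, THEN conjunct2] q(3) in2[OF that] by (metis (no_types))
    then show ?thesis by simp
  qed
  define g h :: "nat + nat \<Rightarrow> nat"
    where "g c = (if c = Inl 1 then 1 else 0)" and "h c = (if c = Inl 0 then 1 else 0)" for c
  have "g \<in> guarded 2" "h \<in> guarded 2"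
    by (auto simp: guarded_def g_def h_def)
  then have "[g, h] \<in> nlists (arity q) (guarded 2)"
    using q(3) by (simp add: nlists_iff)
  then have "(\<lambda>c. app q (map (\<lambda>g. g c) [g, h])) \<in> guarded 2"
    by (rule bspec[OF q(2)[unfolded compatible_def]])
  then have r: "(\<lambda>c. app q [g c, h c]) \<in> guarded 2"
    by simp
  have "app q [0, 1] \<in> {0, 1}"
    using guardedD(2)[OF r, of 0] by (simp add: g_def h_def)
  moreover have "app q [0, 1] \<noteq> 0"
  proof
    assume z: "app q [0, 1] = 0"
    obtain i where "i < 2" "app q [g (Inl i), h (Inl i)] \<noteq> 0 \<or> app q [g (Inr i), h (Inr i)] \<noteq> 0"
      using guardedD(4)[OF r] by blast
    then show False
      using z comm idem[of 0] by (cases "i = 0"; cases "i = 1") (auto simp: g_def h_def)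
  qed
  ultimately have 1: "app q [0, 1] = 1" "app q [1, 0] = 1"
    using comm by auto
  have 2: "app q [1, 2] = 2" "app q [2, 1] = 2"
    using rot[of 0 1] rot[of 1 0] 1 by simp_all
  have 3: "app q [2, 0] = 0" "app q [0, 2] = 0"
    using rot[of 1 2] rot[of 2 1] 2 by simp_all
  show ?thesis
  proof (rule operation_eqI)
    show "q \<in> operations three" "rps_op \<in> operations three" "arity q = arity rps_op"
      using q self_dual_rps by (simp_all add: self_dual_iff)
    fix xs assume "xs \<in> nlists (arity q) three"
    then have "xs \<in> nlists 2 three" using q(3) by simp
    then obtain x y where xs: "xs = [x, y]" and xy: "x \<in> three" "y \<in> three"
      by (rule nlists_2E)
    have "x = 0 \<or> x = 1 \<or> x = 2" "y = 0 \<or> y = 1 \<or> y = 2"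
      using xy by auto
    then have "app q [x, y] = rps x y"
      by (elim disjE) (simp_all only: rps_table 1 2 3 idem insert_iff simp_thms)
    then show "app q xs = app rps_op xs"
      by (simp only: xs app_rps_op[OF xy])
  qed
qed

text \<open>Commutativity is an identity, so it passes from \<open>rps_op\<close> to its image,
  which is \<open>rps_op\<close> again by \<open>rps_unique\<close>. Then \<open>\<phi>\<close>
  fixes every operation and is an inclusion.\<close>

lemma peak_clone_hom_subset:
  assumes S: "2 \<notin> S" and T: "2 \<notin> T"
    and \<phi>: "clone_hom three (peak_clone S) three (peak_clone T) \<phi>"
  shows "peak_clone S \<subseteq> peak_clone T"
proof
  have D: "self_dual f" "compatible f (guarded 2)" if "f \<in> peak_clone U" "2 \<notin> U" for f U
    using that by (auto simp: peak_clone_def)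
  have rps: "rps_op \<in> peak_clone S"
    using self_dual_rps rps_compatible by (auto simp: peak_clone_def)
  define q where "q = \<phi> rps_op"
  have q: "q \<in> peak_clone T" "arity q = 2"
    using clone_homD(1,2)[OF \<phi> rps] by (simp_all add: q_def)
  define ps where "ps = [proj three 2 1, proj three 2 0]"
  have ps: "ps \<in> lists (peak_clone S)" "composable 2 rps_op ps"
    using clone_proj[OF clone_peak_clone] by (simp_all add: ps_def composable_def)
  have "comp_op three 2 rps_op ps = rps_op"
  proof (rule operation_eqI)
    show "comp_op three 2 rps_op ps \<in> operations three"
      using clone_comp[OF clone_peak_clone rps ps] D(1)[OF _ S] by (simp add: self_dual_iff)
    show "rps_op \<in> operations three" "arity (comp_op three 2 rps_op ps) = arity rps_op"
      using rps_operation by simp_all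
    fix xs assume "xs \<in> nlists (arity (comp_op three 2 rps_op ps)) three"
    then have xs: "xs \<in> nlists 2 three" by simp
    then obtain x y where xy: "xs = [x, y]" "x \<in> three" "y \<in> three"
      by (rule nlists_2E)
    have "rps y x = rps x y"
      using xy(2,3) by (auto simp: rps_table)
    then show "app (comp_op three 2 rps_op ps) xs = app rps_op xs"
      using xs xy by (simp add: app_comp_op ps_def app_proj app_rps_op del: insert_iff)
  qed
  then have comm: "q = comp_op three 2 q ps"
    using clone_homD(4)[OF \<phi> rps ps] clone_homD(3)[OF \<phi>] by (simp add: q_def ps_def)
  have "app q [0, 1] = app q [1, 0]"
  proof -
    have "[0, 1] \<in> nlists 2 three" by (simp add: nlists_iff)
    then have "app (comp_op three 2 q ps) [0, 1] = app q [1, 0]"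
      by (simp add: app_comp_op ps_def app_proj)
    then show ?thesis using comm by simp
  qed
  then have "q = rps_op"
    using D[OF q(1) T] q(2) by (intro rps_unique)
  then have rps_fixed: "\<phi> rps_op = rps_op"
    by (simp add: q_def)
  have sdi: "self_dual f \<and> idempotent f" if "f \<in> peak_clone S" for f
    using D[OF that S] idempotent_if_compatible by blast
  have ops: "peak_clone T \<subseteq> operations three"
    using clone_peak_clone[of T] unfolding clone_def by blast
  have fixed: "\<phi> f = f" if "f \<in> peak_clone S" for f
    by (rule clone_hom_fixes[OF clone_peak_clone _ ops \<phi> rps rps_fixed that]) (rule sdi)
  show "f \<in> peak_clone T" if "f \<in> peak_clone S" for f
    using clone_homD(1)[OF \<phi> that] fixed[OF that] by simp
qed

lemma spike_in_peak_clone: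
  assumes "2 \<le> n"
  shows "spike_op n \<in> peak_clone S \<longleftrightarrow> n \<in> S"
  using assms self_dual_spike[of n] spike_compatible[OF assms] spike_incompatible[OF assms]
  by (auto simp: peak_clone_def)

lemma index_subset_if_peak_clone_hom:
  assumes "2 \<notin> S" "2 \<notin> T" "S \<subseteq> {2..}"
    and "clone_hom three (peak_clone S) three (peak_clone T) \<phi>"
  shows "S \<subseteq> T"
proof
  fix n assume n: "n \<in> S"
  then have "2 \<le> n" using assms(3) by auto
  then show "n \<in> T"
    using peak_clone_hom_subset[OF assms(1,2,4)] spike_in_peak_clone n by blast
qed

section \<open>Counting the classes\<close>

lemma countable_operations:
  assumes "finite A"
  shows "countable (operations A)"
proof -
  have "finite (nlists n A)" for n
    using finite_lists_length_eq[OF assms, of n] by (simp add: nlists_def conj_commute)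
  then have "finite (nlists n A \<rightarrow>\<^sub>E A)" for n
    using assms by (intro finite_PiE)
  then show ?thesis
    unfolding operations_def by (intro countable_SIGMA) (auto intro: countable_finite)
qed

theorem corollary3p3:
  "(self_dual_clones // hom_equivalence) \<approx> (UNIV :: nat set set)"
proof (rule lepoll_antisym)
  \<comment> \<open>Every class has a representative, and a clone is a subset of the countable set
    of all operations.\<close>
  have "self_dual_clones // hom_equivalence \<lesssim> self_dual_clones"
    unfolding quotient_def by (rule subset_image_lepoll[of _ "\<lambda>C. hom_equivalence `` {C}"]) blast
  also have "self_dual_clones \<lesssim> (UNIV :: nat set set)"
    unfolding lepoll_def
  proof (intro exI conjI)
    have "inj_on (to_nat_on (operations three)) (operations three)"
      by (intro inj_on_to_nat_on countable_operations) simp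
    then have "inj_on ((`) (to_nat_on (operations three))) (Pow (operations three))"
      by (rule inj_on_image_Pow)
    moreover have "self_dual_clones \<subseteq> Pow (operations three)"
      by (auto simp: self_dual_clones_def clone_def)
    ultimately show "inj_on ((`) (to_nat_on (operations three))) self_dual_clones"
      by (rule inj_on_subset)
  qed simp
  finally show "self_dual_clones // hom_equivalence \<lesssim> (UNIV :: nat set set)" .
next
  \<comment> \<open>Adding \<open>3\<close> turns arbitrary sets of naturals into index sets that
    avoid \<open>2\<close> and lie in the range where the operations \<open>spike_op n\<close> tell
    the clones apart.\<close>
  define \<Phi> where "\<Phi> X = peak_clone ((+) 3 ` X)" for X
  have sub: "X \<subseteq> Y" if "clone_hom three (\<Phi> X) three (\<Phi> Y) \<phi>" for X Y \<phi>
  proof -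
    have "(+) 3 ` X \<subseteq> (+) 3 ` Y"
      using that unfolding \<Phi>_def by (intro index_subset_if_peak_clone_hom[of "(+) 3 ` X" "(+) 3 ` Y" \<phi>]) auto
    then show ?thesis by (simp add: inj_image_subset_iff)
  qed
  show "(UNIV :: nat set set) \<lesssim> self_dual_clones // hom_equivalence"
    unfolding lepoll_def
  proof (intro exI conjI)
    show "inj (\<lambda>X. hom_equivalence `` {\<Phi> X})"
    proof (rule injI)
      fix X Y assume "hom_equivalence `` {\<Phi> X} = hom_equivalence `` {\<Phi> Y}"
      then have "(\<Phi> X, \<Phi> Y) \<in> hom_equivalence"
        using eq_equiv_class_iff[OF equiv_hom_equivalence] peak_clone_self_dual_clones
        unfolding \<Phi>_def by blast
      then show "X = Y"
        unfolding hom_equivalence_def hom_equivalent_def using sub by blast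
    qed
    show "range (\<lambda>X. hom_equivalence `` {\<Phi> X}) \<subseteq> self_dual_clones // hom_equivalence"
      using peak_clone_self_dual_clones unfolding \<Phi>_def by (blast intro: quotientI)
  qed
qed

end
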